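(* Let $p$ be an odd prime and let $G$ be a $p$-group of order $p^m$ of rank $5$ with $G\in\Phi_5$. Then (1) $\displaystyle A_G(t/|G|)=\frac{1-p^{-4}}{1-p^{-1}t} + \frac{p^{-4}}{1-t}$; (2) $\displaystyle B_G(t/|G|)=\frac{1}{1-p^{-4}t} + \frac{-p-1-p^{-1}-p^{-2}}{1-p^{-3}t} + \frac{p+1+p^{-1}+p^{-2}}{1-p^{-2}t}$.
   Context: For a finite group $G$ and $n\ge 0$, $\alpha_{G,n}$ denotes the number of orbits of $G$ acting on $G^n$ by simultaneous conjugation $g\cdot(x_1,\dots,x_n)=(gx_1g^{-1},\dots,gx_ng^{-1})$, and $\beta_{G,n}$ denotes the number of orbits of the same action on the set $G^{(n)}$ of $n$-tuples of pairwise commuting elements of $G$; $\alpha_{G,0}=\beta_{G,0}=1$. Set $A_G(t)=\sum_{n\ge 0}\alpha_{G,n}t^n$ and $B_G(t)=\sum_{n\ge 0}\beta_{G,n}t^n$ (formal power series, which are rational functions of $t$). $A_G(t/|G|)$, $B_G(t/|G|)$ denote the result of substituting $t/|G|$ for $t$. Finite groups $G,H$ are isoclinic if there are isomorphisms $\theta:G/Z(G)\to H/Z(H)$ and $\phi:G'\to H'$ (derived subgroups) such that $\phi([g_1,g_2])=[h_1,h_2]$ whenever $\theta(g_iZ(G))=h_iZ(H)$ for $i=1,2$. Isoclinism is an equivalence relation, whose classes are called isoclinism families. For a $p$-group $G$, the rank of (the family of) $G$ is the smallest $r$ such that the isoclinism family of $G$ contains a group of order $p^r$. $\Phi_5$ (James's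 notation) is the isoclinism family, of rank 5, of the group of order $p^5$ $$\Phi_5(1^5)=\langle \alpha_1, \alpha_2, \alpha_3, \alpha_4, \beta\mid[\alpha_1,\alpha_2]=[\alpha_3, \alpha_4]=\beta,\ \alpha_1^p=\alpha_2^p=\alpha_3^p=\alpha_4^p=\beta^p=1 \rangle .$$ Here $[x,y]=x^{-1}y^{-1}xy$, and by convention all pairs of generators whose commutator is not listed commute. $G\in\Phi_5$ means $G$ is a finite $p$-group isoclinic to this group. *)

theory Defs
  imports
    Complex_Main
    "HOL-Algebra.Group_Action"
    "HOL-Algebra.Generated_Groups"
    "HOL-Computational_Algebra.Formal_Power_Series"
    "HOL-Computational_Algebra.Primes"
begin

section \<open>Simultaneous conjugation and the two generating functions\<close>

text \<open>An \<open>n\<close>-tuple is a list of length \<open>n\<close>.\<close>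

definition tuples :: "('a, 'b) monoid_scheme \<Rightarrow> nat \<Rightarrow> 'a list set" where
  "tuples G n = {xs. length xs = n \<and> set xs \<subseteq> carrier G}"

definition commuting_tuples :: "('a, 'b) monoid_scheme \<Rightarrow> nat \<Rightarrow> 'a list set" where
  "commuting_tuples G n =
     {xs \<in> tuples G n. \<forall>x\<in>set xs. \<forall>y\<in>set xs. x \<otimes>\<^bsub>G\<^esub> y = y \<otimes>\<^bsub>G\<^esub> x}"

text \<open>The restriction to \<open>E\<close> makes the map extensional, as \<^locale>\<open>group_action\<close> demands.\<close>

definition simult_conj ::
    "('a, 'b) monoid_scheme \<Rightarrow> 'a list set \<Rightarrow> 'a \<Rightarrow> 'a list \<Rightarrow> 'a list" where
  "simult_conj G E g = (\<lambda>xs\<in>E. map (\<lambda>x. g \<otimes>\<^bsub>G\<^esub> x \<otimes>\<^bsub>G\<^esub> inv\<^bsub>G\<^esub> g) xs)"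

definition alpha :: "('a, 'b) monoid_scheme \<Rightarrow> nat \<Rightarrow> nat" where
  "alpha G n = card (orbits G (tuples G n) (simult_conj G (tuples G n)))"

definition beta :: "('a, 'b) monoid_scheme \<Rightarrow> nat \<Rightarrow> nat" where
  "beta G n = card (orbits G (commuting_tuples G n) (simult_conj G (commuting_tuples G n)))"

definition A_series :: "('a, 'b) monoid_scheme \<Rightarrow> real fps" where
  "A_series G = Abs_fps (\<lambda>n. of_nat (alpha G n))"

definition B_series :: "('a, 'b) monoid_scheme \<Rightarrow> real fps" where
  "B_series G = Abs_fps (\<lambda>n. of_nat (beta G n))"

section \<open>Isoclinism\<close>

definition center :: "('a, 'b) monoid_scheme \<Rightarrow> 'a set" where
  "center G = {z \<in> carrier G. \<forall>g\<in>carrier G. z \<otimes>\<^bsub>G\<^esub> g = g \<otimes>\<^bsub>G\<^esub> z}"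

definition commutator :: "('a, 'b) monoid_scheme \<Rightarrow> 'a \<Rightarrow> 'a \<Rightarrow> 'a" where
  "commutator G x y = inv\<^bsub>G\<^esub> x \<otimes>\<^bsub>G\<^esub> inv\<^bsub>G\<^esub> y \<otimes>\<^bsub>G\<^esub> x \<otimes>\<^bsub>G\<^esub> y"

text \<open>
  \<^const>\<open>derived\<close> is generated by the elements \<open>x y x\<^sup>-\<^sup>1 y\<^sup>-\<^sup>1\<close>, which range over the same set as
  the commutators \<open>x\<^sup>-\<^sup>1 y\<^sup>-\<^sup>1 x y\<close>.
\<close>

definition derived_group :: "('a, 'b) monoid_scheme \<Rightarrow> ('a, 'b) monoid_scheme" where
  "derived_group G = G\<lparr>carrier := derived G (carrier G)\<rparr>"

definition isoclinic :: "('a, 'b) monoid_scheme \<Rightarrow> ('c, 'd) monoid_scheme \<Rightarrow> bool" where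
  "isoclinic G H \<longleftrightarrow>
     (\<exists>\<theta> \<phi>. \<theta> \<in> iso (G Mod center G) (H Mod center H) \<and>
            \<phi> \<in> iso (derived_group G) (derived_group H) \<and>
            (\<forall>g1\<in>carrier G. \<forall>g2\<in>carrier G. \<forall>h1\<in>carrier H. \<forall>h2\<in>carrier H.
               \<theta> (center G #>\<^bsub>G\<^esub> g1) = center H #>\<^bsub>H\<^esub> h1 \<longrightarrow>
               \<theta> (center G #>\<^bsub>G\<^esub> g2) = center H #>\<^bsub>H\<^esub> h2 \<longrightarrow>
               \<phi> (commutator G g1 g2) = commutator H h1 h2))"

text \<open>
  Every finite group has an isomorphic copy whose carrier consists of natural numbers, so letting
  \<open>H\<close> range over groups of type \<^typ>\<open>nat monoid\<close> covers all finite members of the family.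
\<close>

definition isoclinism_rank :: "nat \<Rightarrow> ('a, 'b) monoid_scheme \<Rightarrow> nat" where
  "isoclinism_rank p G =
     (LEAST r. \<exists>H :: nat monoid. group H \<and> order H = p ^ r \<and> isoclinic G H)"

section \<open>Groups given by generators and relations\<close>

text \<open>
  The letter \<open>(x, True)\<close> stands for the generator \<open>x\<close> and \<open>(x, False)\<close> for its inverse.
  All elements of the type \<open>'g\<close> are generators, and \<open>(u, v) \<in> R\<close> stands for the relation \<open>u = v\<close>.
\<close>

type_synonym 'g word = "('g \<times> bool) list"

inductive pres_eq :: "('g word \<times> 'g word) set \<Rightarrow> 'g word \<Rightarrow> 'g word \<Rightarrow> bool"
  for R :: "('g word \<times> 'g word) set" where
  refl: "pres_eq R u u"
| sym: "pres_eq R u v \<Longrightarrow> pres_eq R v u"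
| trans: "pres_eq R u v \<Longrightarrow> pres_eq R v w \<Longrightarrow> pres_eq R u w"
| app: "pres_eq R u u' \<Longrightarrow> pres_eq R v v' \<Longrightarrow> pres_eq R (u @ v) (u' @ v')"
| cancel: "pres_eq R [(x, b), (x, \<not> b)] []"
| rel: "(u, v) \<in> R \<Longrightarrow> pres_eq R u v"

definition pres_rel :: "('g word \<times> 'g word) set \<Rightarrow> ('g word \<times> 'g word) set" where
  "pres_rel R = {(u, v). pres_eq R u v}"

definition presented_group :: "('g word \<times> 'g word) set \<Rightarrow> 'g word set monoid" where
  "presented_group R =
     \<lparr>carrier = UNIV // pres_rel R,
      monoid.mult = (\<lambda>A B. \<Union>u\<in>A. \<Union>v\<in>B. pres_rel R `` {u @ v}),
      one = pres_rel R `` {[]}\<rparr>"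

definition inv_word :: "'g word \<Rightarrow> 'g word" where
  "inv_word u = rev (map (\<lambda>(x, b). (x, \<not> b)) u)"

definition comm_word :: "'g word \<Rightarrow> 'g word \<Rightarrow> 'g word" where
  "comm_word u v = inv_word u @ inv_word v @ u @ v"

lemma equiv_pres_rel: "equiv UNIV (pres_rel R)"
proof (rule equivI)
  show "refl_on UNIV (pres_rel R)"
    by (simp add: refl_on_def pres_rel_def pres_eq.refl)
  show "sym (pres_rel R)"
    by (rule symI) (simp add: pres_rel_def pres_eq.sym)
  show "trans (pres_rel R)"
    by (rule transI) (auto simp: pres_rel_def intro: pres_eq.trans)
qed simp

lemma mult_presented_group:
  "pres_rel R `` {u} \<otimes>\<^bsub>presented_group R\<^esub> pres_rel R `` {v} = pres_rel R `` {u @ v}"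
proof -
  have *: "pres_rel R `` {a @ b} = pres_rel R `` {u @ v}"
    if "a \<in> pres_rel R `` {u}" "b \<in> pres_rel R `` {v}" for a b
  proof -
    have "(u @ v, a @ b) \<in> pres_rel R"
      using that by (simp add: pres_rel_def pres_eq.app)
    then show ?thesis
      by (rule equiv_class_eq[OF equiv_pres_rel, symmetric])
  qed
  have "u \<in> pres_rel R `` {u}" "v \<in> pres_rel R `` {v}"
    by (simp_all add: pres_rel_def pres_eq.refl)
  then have "(\<Union>a\<in>pres_rel R `` {u}. \<Union>b\<in>pres_rel R `` {v}. pres_rel R `` {a @ b}) =
             pres_rel R `` {u @ v}"
    using * by blast
  then show ?thesis by (simp add: presented_group_def)
qed

lemma pres_eq_inv_word: "pres_eq R (inv_word u @ u) []"
proof (induction u)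
  case Nil
  show ?case by (simp add: inv_word_def pres_eq.refl)
next
  case (Cons a u)
  obtain x b where a: "a = (x, b)" by force
  have "pres_eq R [(x, \<not> b), (x, b)] []"
    using pres_eq.cancel[of R x "\<not> b"] by simp
  then have "pres_eq R (inv_word u @ [(x, \<not> b), (x, b)] @ u) (inv_word u @ [] @ u)"
    by (intro pres_eq.app pres_eq.refl)
  then have "pres_eq R (inv_word (a # u) @ a # u) (inv_word u @ u)"
    by (simp add: inv_word_def a)
  then show ?case using Cons.IH by (rule pres_eq.trans)
qed

lemma group_presented_group: "group (presented_group R)"
proof (rule groupI)
  have cl: "\<exists>u. A = pres_rel R `` {u}" if "A \<in> carrier (presented_group R)" for A
    using that by (auto simp: presented_group_def quotient_def)
  have in_carrier: "pres_rel R `` {u} \<in> carrier (presented_group R)" for u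
    by (auto simp: presented_group_def quotient_def)
  have one: "\<one>\<^bsub>presented_group R\<^esub> = pres_rel R `` {[]}"
    by (simp add: presented_group_def)
  show "\<one>\<^bsub>presented_group R\<^esub> \<in> carrier (presented_group R)"
    using in_carrier one by simp
  fix A assume "A \<in> carrier (presented_group R)"
  then obtain u where u: "A = pres_rel R `` {u}" using cl by blast
  show "\<one>\<^bsub>presented_group R\<^esub> \<otimes>\<^bsub>presented_group R\<^esub> A = A"
    by (simp add: u one mult_presented_group)
  have "pres_rel R `` {inv_word u @ u} = pres_rel R `` {[]}"
    by (rule equiv_class_eq[OF equiv_pres_rel]) (simp add: pres_rel_def pres_eq_inv_word)
  then show "\<exists>B\<in>carrier (presented_group R).
      B \<otimes>\<^bsub>presented_group R\<^esub> A = \<one>\<^bsub>presented_group R\<^esub>"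
    by (intro bexI[of _ "pres_rel R `` {inv_word u}"])
      (simp_all add: u one mult_presented_group in_carrier)
  fix B assume "B \<in> carrier (presented_group R)"
  then obtain v where v: "B = pres_rel R `` {v}" using cl by blast
  show "A \<otimes>\<^bsub>presented_group R\<^esub> B \<in> carrier (presented_group R)"
    by (simp add: u v mult_presented_group in_carrier)
  fix C assume "C \<in> carrier (presented_group R)"
  then obtain w where w: "C = pres_rel R `` {w}" using cl by blast
  show "A \<otimes>\<^bsub>presented_group R\<^esub> B \<otimes>\<^bsub>presented_group R\<^esub> C =
        A \<otimes>\<^bsub>presented_group R\<^esub> (B \<otimes>\<^bsub>presented_group R\<^esub> C)"
    by (simp add: u v w mult_presented_group)
qed

section \<open>The family \<open>\<Phi>\<^sub>5\<close>\<close>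

datatype Phi5_gen = Alpha1 | Alpha2 | Alpha3 | Alpha4 | Beta

definition gen :: "'g \<Rightarrow> 'g word" where
  "gen x = [(x, True)]"

definition Phi5_relations :: "nat \<Rightarrow> (Phi5_gen word \<times> Phi5_gen word) set" where
  "Phi5_relations p =
     {(comm_word (gen Alpha1) (gen Alpha2), gen Beta), (comm_word (gen Alpha3) (gen Alpha4), gen Beta)} \<union>
     {(comm_word (gen x) (gen y), []) | x y. {x, y} \<noteq> {Alpha1, Alpha2} \<and> {x, y} \<noteq> {Alpha3, Alpha4}} \<union>
     {(concat (replicate p (gen x)), []) | x. True}"

definition Phi5_1_5 :: "nat \<Rightarrow> Phi5_gen word set monoid" where
  "Phi5_1_5 p = presented_group (Phi5_relations p)"

definition in_Phi5 :: "nat \<Rightarrow> ('a, 'b) monoid_scheme \<Rightarrow> bool" where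
  "in_Phi5 p G \<longleftrightarrow>
     group G \<and> (\<exists>k. order G = p ^ k) \<and> isoclinic G (Phi5_1_5 p)"

end

theory Submission
  imports Defs "HOL-Algebra.Multiplicative_Group"
begin

text \<open>
  Isoclinism transports two facts from \<open>\<Phi>\<^sub>5(1\<^sup>5)\<close> to \<open>G\<close>: the derived group is central of order
  \<open>p\<close>, and the center has index \<open>p\<^sup>4\<close>. For the presented group they hold because
  \<open>[u, v] = \<beta>\<close> to the power \<open>\<omega>(u, v)\<close>, where \<open>\<omega>\<close> is the standard symplectic form in the exponent
  sums, and because \<open>\<beta>\<close> survives in the Heisenberg group of order \<open>p\<^sup>5\<close>.

  Burnside's lemma expresses \<open>\<alpha>\<^bsub>G,n\<^esub>\<close> through the orders of centralizers and gives
  \<open>|G| \<beta>\<^bsub>G,n\<^esub>\<close> as the number of commuting \<open>(n+1)\<close>-tuples. The latter satisfies a recursion, because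
  the entries after the first one \<open>x\<close> form a commuting tuple in \<open>C(x)\<close>: for noncentral \<open>x\<close>, the
  subgroup \<open>C(x)\<close> has index \<open>p\<close> and its center is \<open>p\<close> times as large, so that the index of the
  center drops by the factor \<open>p\<^sup>2\<close>, down to abelian groups after two steps.
\<close>

section \<open>Counting commuting tuples\<close>

text \<open>A nontrivial subgroup of a group of prime order is the whole group, so \<open>h\<close>
  is onto, and the first isomorphism theorem counts the cosets of the kernel.\<close>

lemma (in group_hom) order_eq_mult_card_kernel:
  assumes "prime (order H)" and "x \<in> carrier G" "h x \<noteq> \<one>\<^bsub>H\<^esub>"
  shows "order G = order H * card (kernel G H h)"
proof -
  have img: "subgroup (h ` carrier G) H"
    using img_is_subgroup .
  have finH: "finite (carrier H)"
    using assms(1) by (metis H.order_gt_0_iff_finite prime_gt_0_nat)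
  have "card (h ` carrier G) dvd order H"
    using H.lagrange[OF img] by (metis dvd_triv_right)
  moreover have "card (h ` carrier G) \<noteq> 1"
  proof
    assume "card (h ` carrier G) = 1"
    then obtain y where "h ` carrier G = {y}" by (rule card_1_singletonE)
    then show False using assms(2,3) subgroup.one_closed[OF img] by (metis imageI singletonD)
  qed
  ultimately have "card (h ` carrier G) = order H"
    using assms(1) by (auto simp: prime_nat_iff)
  then have "h ` carrier G = carrier H"
    by (intro card_subset_eq finH) (auto simp: order_def)
  then have "bij_betw (\<lambda>X. the_elem (h ` X)) (carrier (G Mod kernel G H h)) (carrier H)"
    using FactGroup_iso_set by (auto simp: iso_def)
  then have "card (rcosets kernel G H h) = order H"
    by (auto simp: FactGroup_def order_def dest: bij_betw_same_card)
  then show ?thesis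
    using G.lagrange[OF subgroup_kernel] by simp
qed

section \<open>Centralizers and commuting tuples inside a subset of a group\<close>

definition cent :: "('a, 'b) monoid_scheme \<Rightarrow> 'a set \<Rightarrow> 'a \<Rightarrow> 'a set" where
  "cent G K g = {y \<in> K. y \<otimes>\<^bsub>G\<^esub> g = g \<otimes>\<^bsub>G\<^esub> y}"

definition cent_center :: "('a, 'b) monoid_scheme \<Rightarrow> 'a set \<Rightarrow> 'a set" where
  "cent_center G K = {z \<in> K. \<forall>y\<in>K. z \<otimes>\<^bsub>G\<^esub> y = y \<otimes>\<^bsub>G\<^esub> z}"

text \<open>As for \<open>cent\<close> and \<open>cent_center\<close>, \<open>K\<close> is a bare
  set with the product of \<open>G\<close>, so that repeated passage to centralizers stays inside
  one ambient group.\<close>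

definition ctuples :: "('a, 'b) monoid_scheme \<Rightarrow> 'a set \<Rightarrow> nat \<Rightarrow> 'a list set" where
  "ctuples G K n = {xs. length xs = n \<and> set xs \<subseteq> K \<and>
     (\<forall>x\<in>set xs. \<forall>y\<in>set xs. x \<otimes>\<^bsub>G\<^esub> y = y \<otimes>\<^bsub>G\<^esub> x)}"

lemma finite_ctuples: "finite K \<Longrightarrow> finite (ctuples G K n)"
  by (rule finite_subset[OF _ finite_lists_length_eq[of K n]]) (auto simp: ctuples_def)

lemma ctuples_0: "ctuples G K 0 = {[]}"
  by (auto simp: ctuples_def)

lemma ctuples_Suc:
  "ctuples G K (Suc n) = (\<Union>x\<in>K. Cons x ` ctuples G (cent G K x) n)"
proof (intro Set.set_eqI iffI)
  fix xs assume xs: "xs \<in> ctuples G K (Suc n)"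
  then obtain a ys where "xs = a # ys"
    by (cases xs) (auto simp: ctuples_def)
  with xs show "xs \<in> (\<Union>x\<in>K. Cons x ` ctuples G (cent G K x) n)"
    by (auto simp: ctuples_def cent_def subset_iff intro!: bexI[of _ a])
next
  fix xs assume "xs \<in> (\<Union>x\<in>K. Cons x ` ctuples G (cent G K x) n)"
  then show "xs \<in> ctuples G K (Suc n)"
    by (auto simp: ctuples_def cent_def subset_iff)
qed

lemma card_ctuples_Suc:
  assumes "finite K"
  shows "card (ctuples G K (Suc n)) = (\<Sum>x\<in>K. card (ctuples G (cent G K x) n))"
proof -
  have fin: "finite (cent G K x)" for x
    using assms by (simp add: cent_def)
  have "card (ctuples G K (Suc n)) = (\<Sum>x\<in>K. card (Cons x ` ctuples G (cent G K x) n))"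
    unfolding ctuples_Suc
    by (rule card_UN_disjoint) (auto simp: assms finite_ctuples fin)
  then show ?thesis by (simp add: card_image)
qed

lemma cent_eq_self_iff:
  assumes "x \<in> K"
  shows "cent G K x = K \<longleftrightarrow> x \<in> cent_center G K"
proof -
  have "cent G K x = K \<longleftrightarrow> (\<forall>y\<in>K. y \<otimes>\<^bsub>G\<^esub> x = x \<otimes>\<^bsub>G\<^esub> y)"
    unfolding cent_def by blast
  then show ?thesis
    using assms by (auto simp: cent_center_def)
qed

lemma ctuples_abelian:
  assumes "cent_center G K = K"
  shows "ctuples G K n = {xs. set xs \<subseteq> K \<and> length xs = n}"
  using assms unfolding ctuples_def cent_center_def by blast

lemma (in group) cent_subgroup:
  assumes "subgroup K G" "g \<in> carrier G"
  shows "subgroup (cent G K g) G"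
proof (rule subgroupI)
  show "cent G K g \<subseteq> carrier G" using subgroup.subset[OF assms(1)] by (auto simp: cent_def)
next
  have "\<one> \<in> cent G K g" using assms subgroup.one_closed[OF assms(1)] by (auto simp: cent_def)
  then show "cent G K g \<noteq> {}" by blast
next
  fix a assume a: "a \<in> cent G K g"
  then have [simp]: "a \<in> carrier G" using subgroup.subset[OF assms(1)] by (auto simp: cent_def)
  have "inv a \<otimes> g = inv a \<otimes> (g \<otimes> a) \<otimes> inv a"
    using assms(2) by (simp add: m_assoc)
  also have "\<dots> = inv a \<otimes> (a \<otimes> g) \<otimes> inv a"
    using a by (simp add: cent_def)
  also have "\<dots> = g \<otimes> inv a"
    using assms(2) by (simp flip: m_assoc)
  finally have "inv a \<otimes> g = g \<otimes> inv a" .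
  then show "inv a \<in> cent G K g"
    using a subgroup.m_inv_closed[OF assms(1)] by (auto simp: cent_def)
next
  fix a b assume ab: "a \<in> cent G K g" "b \<in> cent G K g"
  then have [simp]: "a \<in> carrier G" "b \<in> carrier G"
    using subgroup.subset[OF assms(1)] by (auto simp: cent_def)
  have "a \<otimes> g = g \<otimes> a" "b \<otimes> g = g \<otimes> b" using ab by (auto simp: cent_def)
  then have "a \<otimes> b \<otimes> g = g \<otimes> (a \<otimes> b)"
    using assms(2) by (metis \<open>a \<in> carrier G\<close> \<open>b \<in> carrier G\<close> m_assoc)
  then show "a \<otimes> b \<in> cent G K g"
    using ab subgroup.m_closed[OF assms(1)] by (auto simp: cent_def)
qed

lemma (in group) cent_center_subgroup:
  assumes "subgroup K G"
  shows "subgroup (cent_center G K) G"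
proof -
  have eq: "cent_center G K = \<Inter> (insert K (cent G K ` K))"
    by (auto simp: cent_center_def cent_def)
  show ?thesis unfolding eq
    using assms cent_subgroup[OF assms] subgroup.subset[OF assms]
    by (intro subgroups_Inter) auto
qed

lemma (in group) center_subgroup: "subgroup (center G) G"
proof -
  have "center G = cent_center G (carrier G)"
    by (auto simp: center_def cent_center_def)
  then show ?thesis using cent_center_subgroup[OF subgroup_self] by simp
qed

lemma (in group) center_normal: "center G \<lhd> G"
proof (rule normal_invI[OF center_subgroup])
  fix x h assume *: "x \<in> carrier G" "h \<in> center G"
  then have h: "h \<in> carrier G" "x \<otimes> h = h \<otimes> x" by (auto simp: center_def)
  then have "x \<otimes> h \<otimes> inv x = h" using *(1) by (simp add: m_assoc)
  then show "x \<otimes> h \<otimes> inv x \<in> center G" using * by simp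
qed

lemma (in group) mult_inv_eq_one_iff:
  assumes "x \<in> carrier G" "y \<in> carrier G"
  shows "x \<otimes> inv y = \<one> \<longleftrightarrow> x = y"
  using assms by (metis inv_closed inv_equality inv_inv r_inv)

section \<open>Groups whose derived group is central of prime order\<close>

text \<open>The index of the center is left to the single counting lemmas, because it changes on
  passing to a centralizer.\<close>

locale small_derived_group = group +
  fixes p :: nat
  assumes fin: "finite (carrier G)"
    and prime_p: "prime p"
    and card_derived: "card (derived G (carrier G)) = p"
    and derived_central: "derived G (carrier G) \<subseteq> center G"
begin

text \<open>Because commutators are central, \<open>y \<mapsto> [y, g]\<close> is a homomorphism
  from \<open>K\<close> to the derived group. Its kernel is the centralizer of \<open>g\<close> in
  \<open>K\<close>, and the map is nontrivial when \<open>g\<close> does not centralize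
  \<open>K\<close>.\<close>

lemma card_cent:
  assumes K: "subgroup K G" and g: "g \<in> carrier G" and nc: "cent G K g \<noteq> K"
  shows "card K = p * card (cent G K g)"
proof -
  define D where "D = derived G (carrier G)"
  define f where "f = (\<lambda>y. y \<otimes> g \<otimes> inv y \<otimes> inv g)"
  have KG: "K \<subseteq> carrier G" using K by (rule subgroup.subset)
  have D: "subgroup D G" unfolding D_def by (rule derived_is_subgroup) simp
  have fD: "f y \<in> D" if "y \<in> carrier G" for y
    unfolding D_def derived_def f_def using that g by (intro generate.incl) auto
  have f1: "f y = \<one> \<longleftrightarrow> y \<otimes> g = g \<otimes> y" if "y \<in> carrier G" for y
    using that g mult_inv_eq_one_iff[of "y \<otimes> g" "g \<otimes> y"]
    by (simp add: f_def inv_mult_group m_assoc)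
  have mult: "f (y \<otimes> z) = f y \<otimes> f z" if "y \<in> carrier G" "z \<in> carrier G" for y z
  proof -
    have fz: "f z \<in> carrier G" "f z \<otimes> y = y \<otimes> f z"
      using fD[OF that(2)] derived_central that(1) by (auto simp: D_def center_def)
    have "inv g \<otimes> (g \<otimes> w) = w" if "w \<in> carrier G" for w
      using that g by (simp flip: m_assoc)
    then have "f (y \<otimes> z) = y \<otimes> f z \<otimes> g \<otimes> inv y \<otimes> inv g"
      unfolding f_def using that g by (simp add: m_assoc inv_mult_group)
    also have "\<dots> = f z \<otimes> y \<otimes> g \<otimes> inv y \<otimes> inv g"
      by (simp only: fz(2))
    also have "\<dots> = f z \<otimes> f y"
      using fz(1) that g by (simp add: f_def m_assoc)
    also have "\<dots> = f y \<otimes> f z"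
      using fD[OF that(1)] fD[OF that(2)] derived_central
      by (auto simp: D_def center_def)
    finally show ?thesis .
  qed
  interpret K: group "G\<lparr>carrier := K\<rparr>" using subgroup_imp_group[OF K] .
  interpret D: group "G\<lparr>carrier := D\<rparr>" using subgroup_imp_group[OF D] .
  \<comment> \<open>The codomain is \<open>D\<close> and not \<open>G\<close>, since
    \<open>order_eq_mult_card_kernel\<close> asks for a codomain of prime order.\<close>
  interpret f: group_hom "G\<lparr>carrier := K\<rparr>" "G\<lparr>carrier := D\<rparr>" f
    by unfold_locales (use KG fD mult in \<open>auto simp: hom_def subset_iff\<close>)
  have "kernel (G\<lparr>carrier := K\<rparr>) (G\<lparr>carrier := D\<rparr>) f = cent G K g"
    using f1 KG by (auto simp: kernel_def cent_def)
  moreover obtain x where "x \<in> K" "f x \<noteq> \<one>"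
    using nc f1 KG by (auto simp: cent_def)
  ultimately show ?thesis
    using f.order_eq_mult_card_kernel[of x] card_derived prime_p
    by (simp add: order_def D_def)
qed

lemma finite_subgroup: "subgroup K G \<Longrightarrow> finite K"
  using fin subgroup.subset finite_subset by blast

text \<open>The identity \<open>C\<^sub>L(g) = Z(K)\<close> for \<open>L = Z(C\<^sub>K(x))\<close> and \<open>g \<notin> C\<^sub>K(x)\<close> holds because
  \<open>C\<^sub>K(x)\<close> is as large as the centralizer of any noncentral element.\<close>

lemma card_cent_center_cent:
  assumes K: "subgroup K G" and x: "x \<in> K" "x \<notin> cent_center G K"
  shows "card (cent_center G (cent G K x)) = p * card (cent_center G K)"
proof -
  have KG: "K \<subseteq> carrier G" using K by (rule subgroup.subset)
  obtain g where g: "g \<in> K" "x \<otimes> g \<noteq> g \<otimes> x"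
    using x by (auto simp: cent_center_def)
  define L where "L = cent_center G (cent G K x)"
  have C: "subgroup (cent G K x) G" using cent_subgroup[OF K] x KG by auto
  have L: "subgroup L G" unfolding L_def by (rule cent_center_subgroup[OF C])
  have xL: "x \<in> L" using x by (auto simp: L_def cent_center_def cent_def)
  have "cent G L g = cent_center G K"
  proof
    show "cent_center G K \<subseteq> cent G L g"
      using x g by (auto simp: cent_center_def cent_def L_def)
    show "cent G L g \<subseteq> cent_center G K"
    proof (rule subsetI, rule ccontr)
      fix y assume y: "y \<in> cent G L g" "y \<notin> cent_center G K"
      have yK: "y \<in> K" using y by (auto simp: cent_def L_def cent_center_def)
      have "p * card (cent G K y) = p * card (cent G K x)"
        using card_cent[OF K, of x] card_cent[OF K, of y] x y yK subgroup.mem_carrier[OF K]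
        by (simp add: cent_eq_self_iff)
      then have "card (cent G K y) = card (cent G K x)"
        using prime_gt_0_nat[OF prime_p] by simp
      moreover have "cent G K x \<subset> cent G K y"
      proof
        show "cent G K x \<subseteq> cent G K y"
          using y by (auto simp: cent_def L_def cent_center_def)
        have "g \<in> cent G K y" using y g by (auto simp: cent_def)
        moreover have "g \<notin> cent G K x" using g by (auto simp: cent_def)
        ultimately show "cent G K x \<noteq> cent G K y" by blast
      qed
      then have "card (cent G K x) < card (cent G K y)"
        by (intro psubset_card_mono) (auto simp: cent_def finite_subgroup[OF K])
      ultimately show False by simp
    qed
  qed
  \<comment> \<open>The element \<open>x\<close> of \<open>L\<close> does not commute with
    \<open>g\<close>, so \<open>card_cent\<close> applies to \<open>L\<close> and \<open>g\<close>
    and yields the factor \<open>p\<close>.\<close>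
  moreover have "cent G L g \<noteq> L" using xL g by (auto simp: cent_def)
  ultimately show ?thesis
    using card_cent[OF L, of g] g KG by (auto simp: L_def)
qed

text \<open>Central elements have centralizer \<open>K\<close>. The function \<open>f\<close> is
  general because it is used both for numbers of commuting tuples and for the powers
  \<open>card C ^ n\<close> in the formula for \<open>alpha\<close>.\<close>

lemma sum_cent_split:
  fixes f :: "'a set \<Rightarrow> real"
  assumes K: "subgroup K G"
    and c: "\<And>x. x \<in> K \<Longrightarrow> x \<notin> cent_center G K \<Longrightarrow> f (cent G K x) = c"
  shows "(\<Sum>x\<in>K. f (cent G K x)) =
    real (card (cent_center G K)) * f K + (real (card K) - real (card (cent_center G K))) * c"
proof -
  have ZK: "cent_center G K \<subseteq> K" by (auto simp: cent_center_def)
  have cent_self: "cent G K x = K" if "x \<in> cent_center G K" for x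
    using that ZK cent_eq_self_iff[of x K G] by auto
  have finK: "finite K" by (rule finite_subgroup[OF K])
  have "(\<Sum>x\<in>K. f (cent G K x)) =
      (\<Sum>x\<in>K - cent_center G K. f (cent G K x)) + (\<Sum>x\<in>cent_center G K. f (cent G K x))"
    by (rule sum.subset_diff[OF ZK finK])
  also have "(\<Sum>x\<in>cent_center G K. f (cent G K x)) = (\<Sum>x\<in>cent_center G K. f K)"
    by (simp add: cent_self)
  also have "(\<Sum>x\<in>K - cent_center G K. f (cent G K x)) = (\<Sum>x\<in>K - cent_center G K. c)"
    using c by (intro sum.cong) auto
  finally show ?thesis
    using ZK finK by (simp add: card_Diff_subset finite_subset card_mono of_nat_diff)
qed

section \<open>Numbers of commuting tuples by the index of the center\<close>

lemma card_ctuples_Suc_split: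
  assumes K: "subgroup K G"
    and c: "\<And>x. x \<in> K \<Longrightarrow> x \<notin> cent_center G K \<Longrightarrow> real (card (ctuples G (cent G K x) n)) = c"
  shows "real (card (ctuples G K (Suc n))) = real (card (cent_center G K)) * real (card (ctuples G K n))
    + (real (card K) - real (card (cent_center G K))) * c"
  using sum_cent_split[OF K, of "\<lambda>C. real (card (ctuples G C n))" c] c
  by (simp add: card_ctuples_Suc[OF finite_subgroup[OF K]])

lemma card_cent_center_pos: "subgroup K G \<Longrightarrow> card (cent_center G K) > 0"
  using cent_center_subgroup finite_subgroup subgroup.one_closed card_gt_0_iff by blast

text \<open>The instances \<open>r = 0\<close> and \<open>r = 1\<close> lead from center index p^2
  to abelian centralizers and from index p^4 to index p^2.\<close>

lemma cent_step:
  assumes K: "subgroup K G" and r: "card K = p ^ (2 * Suc r) * card (cent_center G K)"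
    and x: "x \<in> K" "x \<notin> cent_center G K"
  shows "subgroup (cent G K x) G" "card K = p * card (cent G K x)"
    "card (cent G K x) = p ^ (2 * r) * card (cent_center G (cent G K x))"
proof -
  have xG: "x \<in> carrier G" using x K by (meson subgroup.mem_carrier)
  show "subgroup (cent G K x) G" by (rule cent_subgroup[OF K xG])
  show 1: "card K = p * card (cent G K x)"
    using card_cent[OF K xG] x by (simp add: cent_eq_self_iff)
  show "card (cent G K x) = p ^ (2 * r) * card (cent_center G (cent G K x))"
    using 1 r prime_gt_0_nat[OF prime_p] by (simp add: card_cent_center_cent[OF K x] mult_ac)
qed

text \<open>The number at the end of the name is the exponent of \<open>p\<close> in the index of
  the center of \<open>K\<close>; here \<open>K\<close> is abelian.\<close>

lemma card_ctuples_rank0: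
  assumes K: "subgroup K G" and r: "card K = card (cent_center G K)"
  shows "card (ctuples G K n) = card K ^ n"
proof -
  have "cent_center G K = K"
    using r finite_subgroup[OF K] by (intro card_subset_eq) (auto simp: cent_center_def)
  then show ?thesis
    by (simp add: ctuples_abelian card_lists_length_eq finite_subgroup[OF K])
qed

text \<open>Divided by \<open>card K ^ n\<close>, the counts satisfy b(n+1) = b(n) / p^2 + (1 -
  1/p^2) / p^n. The term with \<open>1 + real p\<close> is a particular solution, and b(0) = 1 fixes
  the coefficient -p of the homogeneous one.\<close>

lemma card_ctuples_rank2:
  assumes K: "subgroup K G" and r: "card K = p ^ 2 * card (cent_center G K)"
  shows "real (card (ctuples G K n)) =
    real (card K) ^ n * ((1 + real p) / real p ^ n - real p / real p ^ (2 * n))"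
proof (induction n)
  case 0
  show ?case by (simp add: ctuples_0)
next
  case (Suc n)
  have p0: "real p \<noteq> 0" using prime_gt_0_nat[OF prime_p] by simp
  define z where "z = real (card (cent_center G K))"
  have k: "real (card K) = real p ^ 2 * z" using r by (simp add: z_def)
  have cent_ctuples: "real (card (ctuples G (cent G K x) n)) = (real (card K) / p) ^ n"
    if "x \<in> K" "x \<notin> cent_center G K" for x
  proof -
    have "card K = p ^ (2 * Suc 0) * card (cent_center G K)" using r by simp
    note C = cent_step[OF K this that]
    have "real (card K) / p = card (cent G K x)" using C(2) p0 by simp
    then show ?thesis using card_ctuples_rank0[OF C(1), of n] C(3) by simp
  qed
  \<comment> \<open>Naming the powers with exponent \<open>n\<close> leaves an identity of rational
    functions in \<open>P\<close>, \<open>q\<close>, \<open>w\<close> and \<open>z\<close>.\<close>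
  define P q w where "P = real p" and "q = P ^ n" and "w = real (card K) ^ n"
  have nz: "P \<noteq> 0" "q \<noteq> 0" using p0 by (auto simp: P_def q_def)
  have q: "real p ^ (i * n) = q ^ i" for i
    by (simp add: P_def q_def mult.commute flip: power_mult)
  from card_ctuples_Suc_split[OF K cent_ctuples]
  have "real (card (ctuples G K (Suc n))) =
      z * (w * ((1 + P) / q - P / q ^ 2)) + (P ^ 2 * z - z) * (w / q)"
    unfolding of_nat_mult Suc q by (simp add: k P_def q_def w_def z_def power_divide)
  also have "\<dots> = (P ^ 2 * z * w) * ((1 + P) / (P * q) - P / (P ^ 2 * q ^ 2))"
    using nz by (simp add: field_simps power_numeral_reduce)
  finally show ?case
    unfolding mult_Suc_right power_add q by (simp add: k w_def P_def q_def)
qed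

text \<open>The analogous recursion has factor 1/p^4, and its inhomogeneous part, coming from
  \<open>card_ctuples_rank2\<close>, consists of multiples of p^(-2n) and p^(-3n). The value at
  \<open>n = 0\<close> gives the homogeneous solution p^(-4n) the coefficient p^4.\<close>

lemma card_ctuples_rank4:
  assumes K: "subgroup K G" and r: "card K = p ^ 4 * card (cent_center G K)"
  shows "real (card (ctuples G K n)) = real (card K) ^ n *
    (real p ^ 4 / real p ^ (4 * n) + (real p ^ 2 + 1) * (1 + real p) / real p ^ (2 * n)
      - (real p ^ 2 + 1) * (1 + real p) * real p / real p ^ (3 * n))"
proof (induction n)
  case 0
  show ?case by (simp add: ctuples_0 algebra_simps power_numeral_reduce)
next
  case (Suc n)
  have p0: "real p \<noteq> 0" using prime_gt_0_nat[OF prime_p] by simp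
  define z where "z = real (card (cent_center G K))"
  have k: "real (card K) = real p ^ 4 * z" using r by (simp add: z_def)
  have cent_ctuples: "real (card (ctuples G (cent G K x) n)) = (real (card K) / p) ^ n *
      ((1 + real p) / real p ^ n - real p / real p ^ (2 * n))"
    if "x \<in> K" "x \<notin> cent_center G K" for x
  proof -
    have "card K = p ^ (2 * Suc 1) * card (cent_center G K)" using r by simp
    note C = cent_step[OF K this that]
    have "real (card K) / p = card (cent G K x)" using C(2) p0 by simp
    then show ?thesis using card_ctuples_rank2[OF C(1), of n] C(3) by simp
  qed
  define P q w where "P = real p" and "q = P ^ n" and "w = real (card K) ^ n"
  have nz: "P \<noteq> 0" "q \<noteq> 0" using p0 by (auto simp: P_def q_def)
  have q: "real p ^ (i * n) = q ^ i" for i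
    by (simp add: P_def q_def mult.commute flip: power_mult)
  from card_ctuples_Suc_split[OF K cent_ctuples]
  have "real (card (ctuples G K (Suc n))) =
      z * (w * (P ^ 4 / q ^ 4 + (P ^ 2 + 1) * (1 + P) / q ^ 2 - (P ^ 2 + 1) * (1 + P) * P / q ^ 3))
      + (P ^ 4 * z - z) * (w / q * ((1 + P) / q - P / q ^ 2))"
    unfolding of_nat_mult Suc q by (simp add: k P_def q_def w_def z_def power_divide)
  also have "\<dots> = (P ^ 4 * z * w) * (P ^ 4 / (P ^ 4 * q ^ 4) + (P ^ 2 + 1) * (1 + P) / (P ^ 2 * q ^ 2)
      - (P ^ 2 + 1) * (1 + P) * P / (P ^ 3 * q ^ 3))"
    using nz by (simp add: field_simps power_numeral_reduce)
  finally show ?case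
    unfolding mult_Suc_right power_add q by (simp add: k w_def P_def q_def)
qed

end

section \<open>The presented group\<close>

lemma (in group) rcos_eq_iff:
  assumes "subgroup N G" "x \<in> carrier G" "y \<in> carrier G"
  shows "N #> x = N #> y \<longleftrightarrow> x \<otimes> inv y \<in> N"
proof -
  have "N #> x = N #> y \<longleftrightarrow> x \<in> N #> y"
    using repr_independence[of x N y] repr_independenceD[of N x y] assms by auto
  then show ?thesis
    using subgroup.rcos_module[OF assms(1) is_group] assms by simp
qed

text \<open>Centrality of commutators becomes commutativity of the quotient by the center, the form
  in which an isomorphism of such quotients transports it.\<close>

lemma (in group) derived_set_subset_center_iff:
  "derived_set G (carrier G) \<subseteq> center G \<longleftrightarrow>
   (\<forall>x\<in>carrier G. \<forall>y\<in>carrier G. center G #> (x \<otimes> y) = center G #> (y \<otimes> x))"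
proof -
  have "x \<otimes> y \<otimes> inv x \<otimes> inv y = (x \<otimes> y) \<otimes> inv (y \<otimes> x)"
    if "x \<in> carrier G" "y \<in> carrier G" for x y
    using that by (simp add: m_assoc inv_mult_group)
  then show ?thesis
    using rcos_eq_iff[OF center_subgroup] by (simp add: subset_iff) blast
qed

section \<open>Commutation up to powers of a central element\<close>

context group
begin

text \<open>An inverse-free form of \<open>[u, v] = b^k\<close> for the convention
  \<open>u^-1 v^-1 u v\<close>. For central \<open>b\<close> the exponent is additive in
  \<open>v\<close> and changes sign when \<open>u\<close> and \<open>v\<close> are swapped.\<close>

definition twist :: "'a \<Rightarrow> 'a \<Rightarrow> 'a \<Rightarrow> int \<Rightarrow> bool" where
  "twist b u v k \<longleftrightarrow> u \<otimes> v = v \<otimes> u \<otimes> b [^] k"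

lemma int_pow_central:
  assumes "b \<in> center G" "x \<in> carrier G"
  shows "b [^] (k::int) \<otimes> x = x \<otimes> b [^] k"
  using subgroup_int_pow_closed[OF center_subgroup assms(1), of k] assms(2)
  by (auto simp: center_def)

lemma twist_sym:
  assumes b: "b \<in> center G" and [simp]: "u \<in> carrier G" "v \<in> carrier G" and t: "twist b u v k"
  shows "twist b v u (- k)"
proof -
  have [simp]: "b \<in> carrier G" using b by (simp add: center_def)
  have "u \<otimes> v \<otimes> b [^] (- k) = v \<otimes> u \<otimes> (b [^] k \<otimes> b [^] (- k))"
    using t by (simp add: twist_def m_assoc)
  then show ?thesis by (simp add: twist_def flip: int_pow_mult)
qed

lemma twist_mult_right:
  assumes b: "b \<in> center G" and [simp]: "u \<in> carrier G" "v \<in> carrier G" "w \<in> carrier G"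
    and t: "twist b u v k" "twist b u w l"
  shows "twist b u (v \<otimes> w) (k + l)"
proof -
  have [simp]: "b \<in> carrier G" using b by (simp add: center_def)
  have "u \<otimes> (v \<otimes> w) = v \<otimes> u \<otimes> (b [^] k \<otimes> w)"
    using t(1) by (simp add: twist_def flip: m_assoc)
  also have "\<dots> = v \<otimes> (u \<otimes> w) \<otimes> b [^] k"
    by (simp add: int_pow_central[OF b] m_assoc)
  also have "\<dots> = v \<otimes> w \<otimes> u \<otimes> (b [^] l \<otimes> b [^] k)"
    using t(2) by (simp add: twist_def m_assoc)
  finally show ?thesis
    by (simp add: twist_def add.commute[of k] flip: int_pow_mult)
qed

lemma twist_inv_right:
  assumes b: "b \<in> center G" and [simp]: "u \<in> carrier G" "v \<in> carrier G" and t: "twist b u v k"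
  shows "twist b u (inv v) (- k)"
proof -
  have [simp]: "b \<in> carrier G" using b by (simp add: center_def)
  have "u \<otimes> inv v = inv v \<otimes> (v \<otimes> u) \<otimes> inv v"
    by (simp flip: m_assoc)
  also have "v \<otimes> u = u \<otimes> v \<otimes> b [^] (- k)"
    using twist_sym[OF b _ _ t] by (simp add: twist_def)
  also have "inv v \<otimes> (u \<otimes> v \<otimes> b [^] (- k)) \<otimes> inv v = inv v \<otimes> u \<otimes> v \<otimes> (b [^] (- k) \<otimes> inv v)"
    by (simp add: m_assoc)
  also have "\<dots> = inv v \<otimes> u \<otimes> b [^] (- k)"
    by (simp add: int_pow_central[OF b] m_assoc) (simp flip: m_assoc)
  finally show ?thesis by (simp add: twist_def)
qed

lemma twist_one_right: "u \<in> carrier G \<Longrightarrow> twist b u \<one> 0"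
  by (simp add: twist_def)

end

section \<open>Exponent sums of words and invariants modulo p\<close>

fun expo :: "'g \<Rightarrow> 'g word \<Rightarrow> int" where
  "expo x [] = 0"
| "expo x ((y, b) # w) = (if y = x then (if b then 1 else - 1) else 0) + expo x w"

lemma expo_append: "expo x (u @ v) = expo x u + expo x v"
  by (induction u) auto

lemma expo_inv_word: "expo x (inv_word u) = - expo x u"
  by (induction u) (auto simp: inv_word_def expo_append)

lemma expo_concat_replicate: "expo x (concat (replicate n u)) = int n * expo x u"
  by (induction n) (auto simp: expo_append algebra_simps)

lemma expo_replicate: "expo x (replicate n (y, True)) = (if x = y then int n else 0)"
  by (induction n) auto

text \<open>The last coordinate of the image of a word in the Heisenberg group \<open>\<int>\<^sup>5\<close> with
  multiplication \<open>(a, b, c, d, e) (a', b', c', d', e') =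
  (a + a', b + b', c + c', d + d', e + e' + a b' + c d')\<close>; the other coordinates are exponent sums.\<close>

fun heis :: "Phi5_gen word \<Rightarrow> int" where
  "heis [] = 0"
| "heis (a # w) = expo Beta [a] + expo Alpha1 [a] * expo Alpha2 w + expo Alpha3 [a] * expo Alpha4 w
     + heis w"

lemma heis_append:
  "heis (u @ v) = heis u + heis v + expo Alpha1 u * expo Alpha2 v + expo Alpha3 u * expo Alpha4 v"
proof (induction u)
  case (Cons a u)
  have e: "expo x (a # u) = expo x [a] + expo x u" for x
    by (cases a) simp
  show ?case
    unfolding e using Cons by (simp add: expo_append algebra_simps)
qed simp

text \<open>In powers of a single generator the bilinear terms of \<open>heis_append\<close> vanish,
  since at most one kind of exponent sum is nonzero; so no binomial coefficients occur.\<close>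

lemma heis_concat_replicate: "heis (concat (replicate n (gen x))) = (if x = Beta then int n else 0)"
  by (induction n) (auto simp: heis_append expo_append expo_concat_replicate[unfolded gen_def] expo_replicate gen_def)

lemma heis_replicate_Beta: "heis (replicate n (Beta, True)) = int n"
  by (induction n) (auto simp: expo_replicate)

lemma expo_comm_word: "expo x (comm_word u v) = 0"
  by (simp add: comm_word_def expo_append expo_inv_word)

definition symp :: "Phi5_gen word \<Rightarrow> Phi5_gen word \<Rightarrow> int" where
  "symp u v = expo Alpha1 u * expo Alpha2 v - expo Alpha2 u * expo Alpha1 v
     + expo Alpha3 u * expo Alpha4 v - expo Alpha4 u * expo Alpha3 v"

lemma symp_append_right: "symp u (v @ w) = symp u v + symp u w"
  by (simp add: symp_def expo_append algebra_simps)

lemma symp_inv_word_right: "symp u (inv_word v) = - symp u v"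
  by (simp add: symp_def expo_inv_word algebra_simps)

lemma symp_commute: "symp v u = - symp u v"
  by (simp add: symp_def)

lemma heis_comm_word_gen: "heis (comm_word (gen x) (gen y)) = symp (gen x) (gen y)"
  by (cases x; cases y) (simp_all add: comm_word_def inv_word_def gen_def symp_def)

lemma symp_gen_eq_0:
  assumes "{x, y} \<noteq> {Alpha1, Alpha2}" "{x, y} \<noteq> {Alpha3, Alpha4}"
  shows "symp (gen x) (gen y) = 0"
  using assms by (cases x; cases y) (auto simp: symp_def gen_def)

lemma Phi5_relations_cases:
  assumes "(u, v) \<in> Phi5_relations p"
  obtains x y where "u = comm_word (gen x) (gen y)" "v = gen Beta" "symp (gen x) (gen y) = 1"
    | x y where "u = comm_word (gen x) (gen y)" "v = []" "symp (gen x) (gen y) = 0"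
    | x where "u = concat (replicate p (gen x))" "v = []"
proof -
  have "symp (gen Alpha1) (gen Alpha2) = 1" "symp (gen Alpha3) (gen Alpha4) = 1"
    by (simp_all add: symp_def gen_def)
  then show thesis
    using assms that symp_gen_eq_0 unfolding Phi5_relations_def by blast
qed

text \<open>\<open>Beta\<close> is excluded in the second part because the relations for the two
  nontrivial commutators equate words with exponent sums 0 and 1 in \<open>Beta\<close>.\<close>

lemma Phi5_relations_invariant:
  assumes "(u, v) \<in> Phi5_relations p"
  shows "heis u mod int p = heis v mod int p"
    and "x \<noteq> Beta \<Longrightarrow> expo x u mod int p = expo x v mod int p"
  using assms
  by (cases rule: Phi5_relations_cases;
      simp add: heis_comm_word_gen heis_concat_replicate heis_replicate_Beta[of 1, simplified]
        expo_comm_word expo_concat_replicate; simp add: gen_def)+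

lemma pres_eq_expo:
  assumes "pres_eq (Phi5_relations p) u v" "x \<noteq> Beta"
  shows "expo x u mod int p = expo x v mod int p"
  using assms
proof induction
  case (app u u' v v')
  then show ?case unfolding expo_append by (intro mod_add_cong)
next
  case (cancel y b)
  show ?case by simp
qed (use Phi5_relations_invariant(2) in auto)

text \<open>With \<open>pres_eq_expo\<close> this makes the map to the Heisenberg group modulo
  \<open>p\<close> well defined. The bilinear terms of \<open>heis_append\<close> involve only
  exponent sums of the alphas, which \<open>pres_eq_expo\<close> controls.\<close>

lemma pres_eq_heis:
  assumes "pres_eq (Phi5_relations p) u v"
  shows "heis u mod int p = heis v mod int p"
  using assms
proof induction
  case (app u u' v v')
  then show ?case unfolding heis_append
    by (intro mod_add_cong mod_mult_cong pres_eq_expo) auto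
next
  case (cancel y b)
  show ?case by (cases y) simp_all
qed (use Phi5_relations_invariant(1) in auto)

section \<open>Commutators of word classes\<close>

abbreviation word_class :: "nat \<Rightarrow> Phi5_gen word \<Rightarrow> Phi5_gen word set" where
  "word_class p w \<equiv> pres_rel (Phi5_relations p) `` {w}"

lemma word_class_eq_iff: "word_class p u = word_class p v \<longleftrightarrow> pres_eq (Phi5_relations p) u v"
  using eq_equiv_class_iff[OF equiv_pres_rel, of u v] by (simp add: pres_rel_def)

lemma carrier_Phi5: "carrier (Phi5_1_5 p) = range (word_class p)"
  by (auto simp: Phi5_1_5_def presented_group_def quotient_def)

lemma word_class_in_carrier [simp]: "word_class p w \<in> carrier (Phi5_1_5 p)"
  by (simp add: carrier_Phi5)

lemma word_class_append:
  "word_class p (u @ v) = word_class p u \<otimes>\<^bsub>Phi5_1_5 p\<^esub> word_class p v"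
  by (simp add: Phi5_1_5_def mult_presented_group)

lemma word_class_Nil: "word_class p [] = \<one>\<^bsub>Phi5_1_5 p\<^esub>"
  by (simp add: Phi5_1_5_def presented_group_def)

interpretation Phi5: group "Phi5_1_5 p" for p
  unfolding Phi5_1_5_def by (rule group_presented_group)

lemma word_class_inv_word: "word_class p (inv_word u) = inv\<^bsub>Phi5_1_5 p\<^esub> word_class p u"
  using pres_eq_inv_word[of "Phi5_relations p" u]
  by (intro Phi5.inv_equality[symmetric])
    (simp_all add: word_class_eq_iff flip: word_class_append word_class_Nil)

abbreviation bet :: "nat \<Rightarrow> Phi5_gen word set" where
  "bet p \<equiv> word_class p (gen Beta)"

text \<open>Induction on the letters. The element \<open>b\<close> is arbitrary because the case of
  the identity is needed to show that \<open>bet p\<close> is central, and only then can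
  \<open>b\<close> be \<open>bet p\<close>.\<close>

lemma twist_word:
  assumes b: "b \<in> center (Phi5_1_5 p)"
    and t: "\<And>x. Phi5.twist p b (word_class p u) (word_class p (gen x)) (symp u (gen x))"
  shows "Phi5.twist p b (word_class p u) (word_class p w) (symp u w)"
proof (induction w)
  case Nil
  then show ?case
    using Phi5.twist_one_right[of "word_class p u" p b] by (simp add: word_class_Nil symp_def)
next
  case (Cons a w)
  obtain x s where a: "a = (x, s)" by force
  have "Phi5.twist p b (word_class p u) (word_class p [a]) (symp u [a])"
  proof (cases s)
    case True
    then show ?thesis using t[of x] by (simp add: a gen_def)
  next
    case False
    then have "[a] = inv_word (gen x)" by (simp add: a gen_def inv_word_def)
    then show ?thesis
      using Phi5.twist_inv_right[OF b _ _ t[of x]] by (simp add: word_class_inv_word symp_inv_word_right)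
  qed
  from Phi5.twist_mult_right[OF b _ _ _ this Cons]
  show ?case by (simp flip: word_class_append symp_append_right)
qed

lemma word_class_comm_word:
  "word_class p u \<otimes>\<^bsub>Phi5_1_5 p\<^esub> word_class p v =
   word_class p v \<otimes>\<^bsub>Phi5_1_5 p\<^esub> word_class p u \<otimes>\<^bsub>Phi5_1_5 p\<^esub> word_class p (comm_word u v)"
  (is "?u \<otimes>\<^bsub>?G\<^esub> ?v = _")
proof -
  have "?v \<otimes>\<^bsub>?G\<^esub> ?u \<otimes>\<^bsub>?G\<^esub> word_class p (comm_word u v) =
      ?v \<otimes>\<^bsub>?G\<^esub> (?u \<otimes>\<^bsub>?G\<^esub> inv\<^bsub>?G\<^esub> ?u) \<otimes>\<^bsub>?G\<^esub> inv\<^bsub>?G\<^esub> ?v \<otimes>\<^bsub>?G\<^esub> ?u \<otimes>\<^bsub>?G\<^esub> ?v"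
    unfolding comm_word_def word_class_append word_class_inv_word
    by (simp only: Phi5.m_assoc Phi5.m_closed Phi5.inv_closed word_class_in_carrier)
  then show ?thesis by simp
qed

lemma word_class_relation:
  "(u, v) \<in> Phi5_relations p \<Longrightarrow> word_class p u = word_class p v"
  by (simp add: word_class_eq_iff pres_eq.rel)

lemma bet_central: "bet p \<in> center (Phi5_1_5 p)"
proof -
  have one: "\<one>\<^bsub>Phi5_1_5 p\<^esub> \<in> center (Phi5_1_5 p)" by (simp add: center_def)
  \<comment> \<open>Twisting by the identity means commuting, whatever the exponent;
    \<open>symp\<close> stands there to fit \<open>twist_word\<close>.\<close>
  have "Phi5.twist p \<one>\<^bsub>Phi5_1_5 p\<^esub> (bet p) (word_class p (gen x)) (symp (gen Beta) (gen x))" for x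
  proof -
    have "word_class p (comm_word (gen Beta) (gen x)) = word_class p []"
      by (rule word_class_relation) (auto simp: Phi5_relations_def doubleton_eq_iff)
    then show ?thesis
      using word_class_comm_word[of p "gen Beta" "gen x"]
      by (simp add: Phi5.twist_def word_class_Nil symp_def gen_def)
  qed
  from twist_word[OF one this]
  have "bet p \<otimes>\<^bsub>Phi5_1_5 p\<^esub> word_class p w = word_class p w \<otimes>\<^bsub>Phi5_1_5 p\<^esub> bet p" for w
    by (simp add: Phi5.twist_def)
  then show ?thesis
    by (auto simp: center_def carrier_Phi5)
qed

lemma twist_gen:
  "Phi5.twist p (bet p) (word_class p (gen x)) (word_class p (gen y)) (symp (gen x) (gen y))"
proof -
  have pos: "Phi5.twist p (bet p) (word_class p (gen x)) (word_class p (gen y)) (symp (gen x) (gen y))"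
    if "(x, y) = (Alpha1, Alpha2) \<or> (x, y) = (Alpha3, Alpha4)" for x y
  proof -
    have "word_class p (comm_word (gen x) (gen y)) = bet p"
      using that by (intro word_class_relation) (auto simp: Phi5_relations_def)
    moreover have "symp (gen x) (gen y) = 1"
      using that by (auto simp: symp_def gen_def)
    ultimately show ?thesis
      using word_class_comm_word[of p "gen x" "gen y"] by (simp add: Phi5.twist_def)
  qed
  \<comment> \<open>The relations give each of the two nontrivial commutators in one order only; the
    reversed order comes from \<open>twist_sym\<close>.\<close>
  consider "(x, y) = (Alpha1, Alpha2) \<or> (x, y) = (Alpha3, Alpha4)"
    | "(y, x) = (Alpha1, Alpha2) \<or> (y, x) = (Alpha3, Alpha4)"
    | "{x, y} \<noteq> {Alpha1, Alpha2}" "{x, y} \<noteq> {Alpha3, Alpha4}"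
    by (auto simp: doubleton_eq_iff)
  then show ?thesis
  proof cases
    case 1
    then show ?thesis by (rule pos)
  next
    case 2
    from Phi5.twist_sym[OF bet_central _ _ pos[OF this]]
    show ?thesis by (simp flip: symp_commute)
  next
    case 3
    have "word_class p (comm_word (gen x) (gen y)) = word_class p []"
      using 3 by (intro word_class_relation) (auto simp: Phi5_relations_def)
    then show ?thesis
      using word_class_comm_word[of p "gen x" "gen y"] symp_gen_eq_0[OF 3]
      by (simp add: Phi5.twist_def word_class_Nil)
  qed
qed

text \<open>Extends \<open>twist_gen\<close> first in the right argument and then, after a swap by
  \<open>twist_sym\<close>, in the left one.\<close>

lemma twist_words:
  "Phi5.twist p (bet p) (word_class p u) (word_class p v) (symp u v)"
proof (rule twist_word[OF bet_central])
  fix x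
  have "Phi5.twist p (bet p) (word_class p (gen x)) (word_class p u) (symp (gen x) u)"
    by (rule twist_word[OF bet_central twist_gen])
  from Phi5.twist_sym[OF bet_central _ _ this]
  show "Phi5.twist p (bet p) (word_class p u) (word_class p (gen x)) (symp u (gen x))"
    by (simp flip: symp_commute)
qed

lemma bet_pow: "bet p [^]\<^bsub>Phi5_1_5 p\<^esub> (n::nat) = word_class p (replicate n (Beta, True))"
proof (induction n)
  case (Suc n)
  then show ?case
    by (simp add: gen_def flip: word_class_append replicate_append_same)
qed (simp add: word_class_Nil)

text \<open>A relation of the presentation makes the \<open>p\<close>-th power trivial. Conversely,
  \<open>heis\<close> counts the letters of a power of beta modulo \<open>p\<close>, so a trivial
  power has exponent divisible by \<open>p\<close>.\<close>

lemma ord_bet: "Phi5.ord p (bet p) = p"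
proof (rule dvd_antisym)
  have "concat (replicate n (gen Beta)) = replicate n (Beta, True)" for n
    by (induction n) (auto simp: gen_def)
  then have "(replicate p (Beta, True), []) \<in> Phi5_relations p"
    by (auto simp: Phi5_relations_def intro!: exI[of _ Beta])
  then have "bet p [^]\<^bsub>Phi5_1_5 p\<^esub> p = \<one>\<^bsub>Phi5_1_5 p\<^esub>"
    unfolding bet_pow word_class_Nil[symmetric] by (rule word_class_relation)
  then show "Phi5.ord p (bet p) dvd p"
    by (simp add: Phi5.pow_eq_id)
next
  define n where "n = Phi5.ord p (bet p)"
  have "word_class p (replicate n (Beta, True)) = word_class p []"
    by (simp add: n_def word_class_Nil flip: bet_pow)
  then have "heis (replicate n (Beta, True)) mod int p = heis [] mod int p"
    unfolding word_class_eq_iff by (rule pres_eq_heis)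
  then show "p dvd Phi5.ord p (bet p)"
    by (simp add: heis_replicate_Beta n_def mod_eq_0_iff_dvd)
qed

section \<open>Center and derived group of the presented group\<close>

lemma word_classes_commute_iff:
  "word_class p u \<otimes>\<^bsub>Phi5_1_5 p\<^esub> word_class p v = word_class p v \<otimes>\<^bsub>Phi5_1_5 p\<^esub> word_class p u
   \<longleftrightarrow> int p dvd symp u v"
proof -
  have "word_class p u \<otimes>\<^bsub>Phi5_1_5 p\<^esub> word_class p v =
      word_class p v \<otimes>\<^bsub>Phi5_1_5 p\<^esub> word_class p u \<otimes>\<^bsub>Phi5_1_5 p\<^esub> bet p [^]\<^bsub>Phi5_1_5 p\<^esub> symp u v"
    using twist_words[of p u v] by (simp add: Phi5.twist_def)
  moreover have "bet p [^]\<^bsub>Phi5_1_5 p\<^esub> symp u v = \<one>\<^bsub>Phi5_1_5 p\<^esub> \<longleftrightarrow> int p dvd symp u v"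
    by (simp add: Phi5.int_pow_eq_id ord_bet)
  ultimately show ?thesis
    by (simp add: Phi5.r_cancel_one)
qed

text \<open>Nondegeneracy of \<open>symp\<close>: pairing \<open>w\<close> with each of the four
  alphas isolates, up to sign, the exponent sum of its partner.\<close>

lemma word_class_in_center_iff:
  "word_class p w \<in> center (Phi5_1_5 p) \<longleftrightarrow> (\<forall>x. x \<noteq> Beta \<longrightarrow> int p dvd expo x w)"
proof -
  have "word_class p w \<in> center (Phi5_1_5 p) \<longleftrightarrow> (\<forall>v. int p dvd symp w v)"
    unfolding center_def carrier_Phi5 by (simp add: word_classes_commute_iff)
  also have "\<dots> \<longleftrightarrow> (\<forall>x. x \<noteq> Beta \<longrightarrow> int p dvd expo x w)"
  proof (intro iffI allI impI)
    fix x assume *: "\<forall>v. int p dvd symp w v" and x: "x \<noteq> Beta"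
    show "int p dvd expo x w"
      using x *[rule_format, of "gen Alpha1"] *[rule_format, of "gen Alpha2"]
        *[rule_format, of "gen Alpha3"] *[rule_format, of "gen Alpha4"]
      by (cases x) (auto simp: symp_def gen_def)
  qed (auto simp: symp_def)
  finally show ?thesis .
qed

text \<open>Lets cosets be counted by an invariant of representing words, without a separate check
  that a map on cosets is well defined.\<close>

lemma card_range_eqI:
  assumes "\<And>x y. f x = f y \<longleftrightarrow> g x = g y"
  shows "card (range f) = card (range g)"
proof (rule bij_betw_same_card)
  have "(g \<circ> inv_into UNIV f) (f x) = g x" for x
    using assms[of "inv_into UNIV f (f x)" x] by (simp add: f_inv_into_f)
  then show "bij_betw (g \<circ> inv_into UNIV f) (range f) (range g)"
    using assms by (auto simp: bij_betw_def inj_on_def image_image)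
qed

lemma all_Alpha_iff:
  "(\<forall>x. x \<noteq> Beta \<longrightarrow> P x) \<longleftrightarrow> P Alpha1 \<and> P Alpha2 \<and> P Alpha3 \<and> P Alpha4"
proof (intro iffI allI impI)
  fix x assume "P Alpha1 \<and> P Alpha2 \<and> P Alpha3 \<and> P Alpha4" "x \<noteq> Beta"
  then show "P x" by (cases x) simp_all
qed simp

text \<open>The four exponent sums modulo \<open>p\<close> are a complete invariant of the cosets of
  the center, and every vector of residues occurs.\<close>

lemma order_Phi5_Mod_center: "card (carrier (Phi5_1_5 p Mod center (Phi5_1_5 p))) = p ^ 4"
  if "p > 0"
proof -
  let ?Z = "center (Phi5_1_5 p)"
  define E where "E = (\<lambda>w. (expo Alpha1 w mod int p, expo Alpha2 w mod int p,
    expo Alpha3 w mod int p, expo Alpha4 w mod int p))"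
  have "?Z #>\<^bsub>Phi5_1_5 p\<^esub> word_class p u = ?Z #>\<^bsub>Phi5_1_5 p\<^esub> word_class p v \<longleftrightarrow> E u = E v" for u v
  proof -
    have "?Z #>\<^bsub>Phi5_1_5 p\<^esub> word_class p u = ?Z #>\<^bsub>Phi5_1_5 p\<^esub> word_class p v \<longleftrightarrow>
        word_class p (u @ inv_word v) \<in> ?Z"
      by (simp add: Phi5.rcos_eq_iff[OF Phi5.center_subgroup] word_class_append word_class_inv_word)
    also have "\<dots> \<longleftrightarrow> (\<forall>x. x \<noteq> Beta \<longrightarrow> expo x u mod int p = expo x v mod int p)"
      unfolding word_class_in_center_iff
      by (simp add: expo_append expo_inv_word mod_eq_dvd_iff)
    also have "\<dots> \<longleftrightarrow> E u = E v"
      by (simp add: E_def all_Alpha_iff)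
    finally show ?thesis .
  qed
  then have "card (range (\<lambda>w. ?Z #>\<^bsub>Phi5_1_5 p\<^esub> word_class p w)) = card (range E)"
    by (rule card_range_eqI)
  moreover have "range (\<lambda>w. ?Z #>\<^bsub>Phi5_1_5 p\<^esub> word_class p w) = carrier (Phi5_1_5 p Mod ?Z)"
    by (auto simp: FactGroup_def RCOSETS_def carrier_Phi5)
  moreover have "range E = {0..<int p} \<times> {0..<int p} \<times> {0..<int p} \<times> {0..<int p}"
  proof
    show "range E \<subseteq> {0..<int p} \<times> {0..<int p} \<times> {0..<int p} \<times> {0..<int p}"
      using that by (auto simp: E_def)
    show "{0..<int p} \<times> {0..<int p} \<times> {0..<int p} \<times> {0..<int p} \<subseteq> range E"
    proof clarify
      fix a b c d assume "a \<in> {0..<int p}" "b \<in> {0..<int p}" "c \<in> {0..<int p}" "d \<in> {0..<int p}"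
      then have "(a, b, c, d) = E (replicate (nat a) (Alpha1, True) @ replicate (nat b) (Alpha2, True)
          @ replicate (nat c) (Alpha3, True) @ replicate (nat d) (Alpha4, True))"
        by (simp add: E_def expo_append expo_replicate)
      then show "(a, b, c, d) \<in> range E" by blast
    qed
  qed
  ultimately show ?thesis
    by (simp add: card_cartesian_product numeral_eq_Suc)
qed

lemma Phi5_derived_set:
  "derived_set (Phi5_1_5 p) (carrier (Phi5_1_5 p)) \<subseteq> generate (Phi5_1_5 p) {bet p}"
  "bet p \<in> derived_set (Phi5_1_5 p) (carrier (Phi5_1_5 p))"
proof -
  have *: "word_class p u \<otimes>\<^bsub>Phi5_1_5 p\<^esub> word_class p v \<otimes>\<^bsub>Phi5_1_5 p\<^esub>
      inv\<^bsub>Phi5_1_5 p\<^esub> word_class p u \<otimes>\<^bsub>Phi5_1_5 p\<^esub> inv\<^bsub>Phi5_1_5 p\<^esub> word_class p v =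
      bet p [^]\<^bsub>Phi5_1_5 p\<^esub> symp u v" (is "?u \<otimes>\<^bsub>?G\<^esub> ?v \<otimes>\<^bsub>?G\<^esub> _ \<otimes>\<^bsub>?G\<^esub> _ = ?b") for u v
  proof -
    have "?u \<otimes>\<^bsub>?G\<^esub> ?v = ?v \<otimes>\<^bsub>?G\<^esub> ?u \<otimes>\<^bsub>?G\<^esub> ?b"
      using twist_words[of p u v] by (simp add: Phi5.twist_def)
    also have "\<dots> = ?b \<otimes>\<^bsub>?G\<^esub> (?v \<otimes>\<^bsub>?G\<^esub> ?u)"
      by (simp add: Phi5.int_pow_central[OF bet_central])
    finally show ?thesis by (simp add: Phi5.m_assoc)
  qed
  show "derived_set (Phi5_1_5 p) (carrier (Phi5_1_5 p)) \<subseteq> generate (Phi5_1_5 p) {bet p}"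
    unfolding carrier_Phi5 by (auto simp: * Phi5.generate_pow)
  have "bet p = bet p [^]\<^bsub>Phi5_1_5 p\<^esub> symp (gen Alpha1) (gen Alpha2)"
    by (simp add: symp_def gen_def)
  then show "bet p \<in> derived_set (Phi5_1_5 p) (carrier (Phi5_1_5 p))"
    unfolding *[symmetric]
    by (intro UN_I[of "word_class p (gen Alpha1)"] UN_I[of "word_class p (gen Alpha2)"]) simp_all
qed

lemma card_derived_Phi5: "card (derived (Phi5_1_5 p) (carrier (Phi5_1_5 p))) = p"
proof -
  let ?D = "derived (Phi5_1_5 p) (carrier (Phi5_1_5 p))"
  have "?D = generate (Phi5_1_5 p) {bet p}"
  proof
    show "?D \<subseteq> generate (Phi5_1_5 p) {bet p}"
      unfolding derived_def using Phi5_derived_set(1)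
      by (intro Phi5.generate_subgroup_incl Phi5.generate_is_subgroup) auto
    show "generate (Phi5_1_5 p) {bet p} \<subseteq> ?D"
      unfolding derived_def using Phi5_derived_set(2)
      by (intro Phi5.mono_generate) auto
  qed
  then show ?thesis
    using Phi5.generate_pow_card[of "bet p" p] by (simp add: ord_bet)
qed

lemma derived_set_Phi5_central:
  "derived_set (Phi5_1_5 p) (carrier (Phi5_1_5 p)) \<subseteq> center (Phi5_1_5 p)"
proof -
  have "generate (Phi5_1_5 p) {bet p} \<subseteq> center (Phi5_1_5 p)"
    using bet_central by (intro Phi5.generate_subgroup_incl Phi5.center_subgroup) auto
  then show ?thesis using Phi5_derived_set(1)[of p] by blast
qed

section \<open>Orbits of simultaneous conjugation\<close>

lemma (in group) simult_conj_group_action: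
  assumes E: "E \<subseteq> lists (carrier G)"
    and closed: "\<And>g xs. g \<in> carrier G \<Longrightarrow> xs \<in> E \<Longrightarrow> map (\<lambda>x. g \<otimes> x \<otimes> inv g) xs \<in> E"
  shows "group_action G E (simult_conj G E)"
proof -
  let ?c = "\<lambda>g. map (\<lambda>x. g \<otimes> x \<otimes> inv g)"
  have comp: "?c (g \<otimes> h) xs = ?c g (?c h xs)"
    if "g \<in> carrier G" "h \<in> carrier G" "xs \<in> E" for g h xs
    using that E by (auto simp: m_assoc inv_mult_group subset_iff in_lists_conv_set)
  have one: "?c \<one> xs = xs" if "xs \<in> E" for xs
    using that E by (intro map_idI) (auto simp: in_lists_conv_set)
  have bij: "simult_conj G E g \<in> Bij E" if g: "g \<in> carrier G" for g
  proof -
    have "?c (inv g) (?c g xs) = xs" "?c g (?c (inv g) xs) = xs" if "xs \<in> E" for xs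
      using one[OF that] g
      unfolding comp[OF inv_closed[OF g] g that, symmetric] comp[OF g inv_closed[OF g] that, symmetric]
      by (simp_all only: l_inv r_inv)
    then have "bij_betw (?c g) E E"
      using closed[of g] closed[of "inv g"] g
      by (intro bij_betwI[of _ _ _ "?c (inv g)"]) auto
    then have "bij_betw (simult_conj G E g) E E"
      by (subst bij_betw_cong[of E _ "?c g"]) (auto simp: simult_conj_def)
    then show ?thesis
      by (simp add: Bij_def simult_conj_def)
  qed
  have "simult_conj G E (g \<otimes> h) = compose E (simult_conj G E g) (simult_conj G E h)"
    if "g \<in> carrier G" "h \<in> carrier G" for g h
    unfolding compose_def simult_conj_def
    by (rule restrict_ext) (simp only: restrict_apply' closed[OF that(2)] comp[OF that])
  then have "simult_conj G E \<in> hom G (BijGroup E)"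
    using bij by (auto simp: hom_def BijGroup_def)
  then show ?thesis
    unfolding group_action_def group_hom_def group_hom_axioms_def
    by (simp add: is_group group_BijGroup)
qed

text \<open>Burnside's lemma, where \<open>g\<close> fixes a tuple exactly when it commutes with
  every entry. The set \<open>E\<close> is general to cover all tuples as well as commuting
  ones.\<close>

lemma (in group) card_orbits_simult_conj:
  assumes fin: "finite (carrier G)" "finite E" and E: "E \<subseteq> lists (carrier G)"
    and closed: "\<And>g xs. g \<in> carrier G \<Longrightarrow> xs \<in> E \<Longrightarrow> map (\<lambda>x. g \<otimes> x \<otimes> inv g) xs \<in> E"
  shows "card (orbits G E (simult_conj G E)) * order G =
    (\<Sum>g\<in>carrier G. card {xs \<in> E. set xs \<subseteq> cent G (carrier G) g})"
proof -
  interpret group_action G E "simult_conj G E"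
    by (rule simult_conj_group_action[OF E closed])
  have "invariants E (simult_conj G E) g = {xs \<in> E. set xs \<subseteq> cent G (carrier G) g}"
    if g: "g \<in> carrier G" for g
  proof -
    have "g \<otimes> x \<otimes> inv g = x \<longleftrightarrow> x \<otimes> g = g \<otimes> x" if "x \<in> carrier G" for x
      using that g by (metis inv_solve_right m_closed)
    then have "map (\<lambda>x. g \<otimes> x \<otimes> inv g) xs = xs \<longleftrightarrow> set xs \<subseteq> cent G (carrier G) g" if "xs \<in> E" for xs
      using that E map_eq_conv[of "\<lambda>x. g \<otimes> x \<otimes> inv g" xs id]
      by (auto simp: cent_def in_lists_conv_set)
    then show ?thesis
      by (auto simp: invariants_def simult_conj_def)
  qed
  then show ?thesis
    using burnside[OF fin] by simp
qed

lemma (in group) alpha_mult_order: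
  assumes "finite (carrier G)"
  shows "alpha G n * order G = (\<Sum>g\<in>carrier G. card (cent G (carrier G) g) ^ n)"
proof -
  have "finite (tuples G n)"
    using finite_lists_length_eq[OF assms, of n] by (simp add: tuples_def conj_commute)
  then have "alpha G n * order G =
      (\<Sum>g\<in>carrier G. card {xs \<in> tuples G n. set xs \<subseteq> cent G (carrier G) g})"
    unfolding alpha_def using assms
    by (intro card_orbits_simult_conj) (auto simp: tuples_def)
  also have "\<dots> = (\<Sum>g\<in>carrier G. card (cent G (carrier G) g) ^ n)"
  proof (rule sum.cong[OF HOL.refl])
    fix g
    have "finite (cent G (carrier G) g)" using assms by (simp add: cent_def)
    moreover have "{xs \<in> tuples G n. set xs \<subseteq> cent G (carrier G) g} =
        {xs. set xs \<subseteq> cent G (carrier G) g \<and> length xs = n}"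
      by (auto simp: tuples_def cent_def)
    ultimately show "card {xs \<in> tuples G n. set xs \<subseteq> cent G (carrier G) g} =
        card (cent G (carrier G) g) ^ n"
      by (simp add: card_lists_length_eq)
  qed
  finally show ?thesis .
qed

lemma (in group) beta_mult_order:
  assumes "finite (carrier G)"
  shows "beta G n * order G = card (ctuples G (carrier G) (Suc n))"
proof -
  have eq: "commuting_tuples G n = ctuples G (carrier G) n"
    by (auto simp: commuting_tuples_def tuples_def ctuples_def)
  have conj: "(g \<otimes> x \<otimes> inv g) \<otimes> (g \<otimes> y \<otimes> inv g) = (g \<otimes> y \<otimes> inv g) \<otimes> (g \<otimes> x \<otimes> inv g)"
    if "g \<in> carrier G" "x \<in> carrier G" "y \<in> carrier G" "x \<otimes> y = y \<otimes> x" for g x y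
  proof -
    have "(g \<otimes> x \<otimes> inv g) \<otimes> (g \<otimes> y \<otimes> inv g) = g \<otimes> (x \<otimes> y) \<otimes> inv g"
      if "x \<in> carrier G" "y \<in> carrier G" for x y
    proof -
      have "inv g \<otimes> (g \<otimes> w) = w" if "w \<in> carrier G" for w
        using that \<open>g \<in> carrier G\<close> by (simp flip: m_assoc)
      then show ?thesis using that \<open>g \<in> carrier G\<close> by (simp add: m_assoc)
    qed
    then show ?thesis using that by simp
  qed
  have "beta G n * order G =
      (\<Sum>g\<in>carrier G. card {xs \<in> ctuples G (carrier G) n. set xs \<subseteq> cent G (carrier G) g})"
    unfolding beta_def eq using assms
    by (intro card_orbits_simult_conj finite_ctuples)
      (auto simp: ctuples_def conj subset_iff)
  \<comment> \<open>The commuting tuples fixed by \<open>g\<close> are the commuting tuples inside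
    its centralizer; putting \<open>g\<close> in front of them accounts for the length
    \<open>Suc n\<close>.\<close>
  also have "\<dots> = (\<Sum>g\<in>carrier G. card (ctuples G (cent G (carrier G) g) n))"
    by (intro sum.cong HOL.refl arg_cong[where f = card]) (auto simp: ctuples_def cent_def)
  also have "\<dots> = card (ctuples G (carrier G) (Suc n))"
    by (rule card_ctuples_Suc[OF assms, symmetric])
  finally show ?thesis .
qed

lemma center_eq_cent_center: "center G = cent_center G (carrier G)"
  by (simp add: center_def cent_center_def)

section \<open>Orbit numbers divided by powers of the group order\<close>

context small_derived_group
begin

text \<open>The fraction p^(-4) of the elements is central, with centralizer the whole group; every
  other element has a centralizer of index \<open>p\<close>.\<close>

lemma alpha_div_order_power:
  assumes r: "order G = p ^ 4 * card (center G)"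
  shows "real (alpha G n) / real (order G) ^ n = (1 - 1 / real p ^ 4) / real p ^ n + 1 / real p ^ 4"
proof -
  define N z where "N = real (order G)" and "z = real (card (center G))"
  have z: "z > 0"
    using card_cent_center_pos[OF subgroup_self] by (simp add: z_def center_eq_cent_center)
  have p: "real p > 0" using prime_gt_0_nat[OF prime_p] by simp
  have N: "N = real p ^ 4 * z" using r by (simp add: N_def z_def)
  have N0: "N > 0" using z p by (simp add: N)
  have "real (card (cent G (carrier G) x)) ^ n = (N / p) ^ n"
    if "x \<in> carrier G" "x \<notin> cent_center G (carrier G)" for x
    using card_cent[OF subgroup_self that(1)] that p
    by (simp add: N_def order_def cent_eq_self_iff)
  from sum_cent_split[OF subgroup_self, where f = "\<lambda>C. real (card C) ^ n", OF this]
  have "real (alpha G n * order G) = z * N ^ n + (N - z) * (N / p) ^ n"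
    unfolding alpha_mult_order[OF fin] by (simp add: N_def z_def order_def center_eq_cent_center)
  then have "real (alpha G n) = (z * N ^ n + (N - z) * (N / p) ^ n) / N"
    using N0 by (simp add: N_def field_simps)
  also have "\<dots> = N ^ n * ((z / N) + (1 - z / N) / real p ^ n)"
    using N0 p by (simp add: field_simps)
  also have "z / N = 1 / real p ^ 4"
    using z p by (simp add: N)
  finally show ?thesis
    using N0 by (simp add: N_def)
qed

text \<open>\<open>card_ctuples_rank4\<close> is taken at \<open>Suc n\<close>. The shift divides
  its coefficients by p^4, p^2 and p^3, which turns the last two, up to sign, into the same number
  (p^2 + 1)(p + 1) / p^2.\<close>

lemma beta_div_order_power:
  assumes r: "order G = p ^ 4 * card (center G)"
  shows "real (beta G n) / real (order G) ^ n =
    1 / real p ^ (4 * n) + (real p + 1 + 1 / real p + 1 / real p ^ 2) / real p ^ (2 * n)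
    - (real p + 1 + 1 / real p + 1 / real p ^ 2) / real p ^ (3 * n)"
proof -
  define P where "P = real p"
  define q where "q = P ^ n"
  have P: "P > 0" using prime_gt_0_nat[OF prime_p] by (simp add: P_def)
  have q0: "q > 0" using P by (simp add: q_def)
  have q: "P ^ (i * n) = q ^ i" for i
    by (simp add: q_def mult.commute flip: power_mult)
  have N0: "real (order G) > 0" using fin order_gt_0_iff_finite by simp
  define X where "X = P ^ 4 / P ^ (4 * Suc n) + (P ^ 2 + 1) * (1 + P) / P ^ (2 * Suc n)
      - (P ^ 2 + 1) * (1 + P) * P / P ^ (3 * Suc n)"
  have "real (beta G n * order G) = real (order G) ^ Suc n * X"
    using card_ctuples_rank4[OF subgroup_self, of "Suc n"] r
    unfolding beta_mult_order[OF fin] by (simp add: center_eq_cent_center X_def P_def order_def)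
  then have "real (beta G n) / real (order G) ^ n = X"
    using N0 by (simp add: field_simps)
  also have "X = P ^ 4 / P ^ (4 * Suc n) + (P ^ 2 + 1) * (1 + P) / P ^ (2 * Suc n)
      - (P ^ 2 + 1) * (1 + P) * P / P ^ (3 * Suc n)"
    by (simp only: X_def)
  also have "\<dots> = 1 / P ^ (4 * n) + (P + 1 + 1 / P + 1 / P ^ 2) / P ^ (2 * n)
      - (P + 1 + 1 / P + 1 / P ^ 2) / P ^ (3 * n)"
    unfolding mult_Suc_right power_add q
    using P q0 by (simp add: field_simps power_numeral_reduce)
  finally show ?thesis unfolding P_def .
qed

end

section \<open>Transport along isoclinism\<close>

text \<open>The isomorphism \<theta> gives the index of the center and carries commutativity of the
  quotient back to \<open>G\<close>, so that commutators are central; \<phi> gives the order of the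
  derived group.\<close>

lemma (in group) isoclinic_Phi5:
  assumes fin: "finite (carrier G)" and p: "prime p"
    and iso: "isoclinic G (Phi5_1_5 p)"
  shows "small_derived_group G p" and "order G = p ^ 4 * card (center G)"
proof -
  let ?H = "Phi5_1_5 p"
  obtain \<theta> \<phi> where \<theta>: "\<theta> \<in> iso (G Mod center G) (?H Mod center ?H)"
    and \<phi>: "\<phi> \<in> iso (derived_group G) (derived_group ?H)"
    using iso by (auto simp: isoclinic_def)
  have "card (carrier (G Mod center G)) = card (carrier (?H Mod center ?H))"
    using \<theta> by (auto simp: iso_def dest: bij_betw_same_card)
  then have "card (rcosets center G) = p ^ 4"
    using order_Phi5_Mod_center[OF prime_gt_0_nat[OF p]] by (simp add: FactGroup_def)
  then show "order G = p ^ 4 * card (center G)"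
    using lagrange[OF center_subgroup] by simp
  have card_D: "card (derived G (carrier G)) = p"
    using \<phi> card_derived_Phi5[of p]
    by (auto simp: iso_def derived_group_def dest: bij_betw_same_card)
  interpret Z: normal "center G" G by (rule center_normal)
  interpret ZH: normal "center ?H" ?H by (rule Phi5.center_normal)
  have "center G #> (x \<otimes> y) = center G #> (y \<otimes> x)" if xy: "x \<in> carrier G" "y \<in> carrier G" for x y
  proof -
    have in_Mod: "center G #> w \<in> carrier (G Mod center G)" if "w \<in> carrier G" for w
      using that by (auto simp: FactGroup_def RCOSETS_def)
    have comm: "A \<otimes>\<^bsub>?H Mod center ?H\<^esub> B = B \<otimes>\<^bsub>?H Mod center ?H\<^esub> A"
      if AB: "A \<in> carrier (?H Mod center ?H)" "B \<in> carrier (?H Mod center ?H)" for A B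
    proof -
      obtain a b where "a \<in> carrier ?H" "b \<in> carrier ?H"
        "A = center ?H #>\<^bsub>?H\<^esub> a" "B = center ?H #>\<^bsub>?H\<^esub> b"
        using AB by (auto simp: FactGroup_def RCOSETS_def)
      then show ?thesis
        using derived_set_Phi5_central[of p]
        by (simp add: FactGroup_def ZH.rcos_sum Phi5.derived_set_subset_center_iff)
    qed
    have hom: "\<theta> (center G #> (u \<otimes> v)) =
        \<theta> (center G #> u) \<otimes>\<^bsub>?H Mod center ?H\<^esub> \<theta> (center G #> v)"
      if "u \<in> carrier G" "v \<in> carrier G" for u v
    proof -
      have "center G #> (u \<otimes> v) = (center G #> u) \<otimes>\<^bsub>G Mod center G\<^esub> (center G #> v)"
        using that by (simp add: FactGroup_def Z.rcos_sum)
      then show ?thesis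
        using hom_mult[of \<theta> "G Mod center G" "?H Mod center ?H"] \<theta> in_Mod that
        by (simp add: iso_def)
    qed
    have closed: "\<theta> (center G #> u) \<in> carrier (?H Mod center ?H)" if "u \<in> carrier G" for u
      using \<theta> in_Mod[OF that] by (auto simp: iso_def hom_def)
    have "\<theta> (center G #> (x \<otimes> y)) = \<theta> (center G #> (y \<otimes> x))"
      using xy comm[OF closed closed] by (simp add: hom)
    moreover have "inj_on \<theta> (carrier (G Mod center G))"
      using \<theta> by (auto simp: iso_def bij_betw_def)
    ultimately show ?thesis
      using xy in_Mod by (auto dest: inj_onD)
  qed
  then have "derived_set G (carrier G) \<subseteq> center G"
    by (simp add: derived_set_subset_center_iff)
  then have "derived G (carrier G) \<subseteq> center G"
    unfolding derived_def by (rule generate_subgroup_incl[OF _ center_subgroup])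
  then show "small_derived_group G p"
    using fin p card_D by unfold_locales
qed

section \<open>Geometric series and the generating functions\<close>

lemma fps_const_div_one_minus_const_X:
  fixes a c :: "'a :: field"
  shows "fps_const a / (1 - fps_const c * fps_X) = Abs_fps (\<lambda>n. a * c ^ n)"
proof -
  have "Abs_fps (\<lambda>n. a * c ^ n) * (1 - fps_const c * fps_X) = fps_const a"
  proof (rule fps_ext)
    fix n
    have "Abs_fps (\<lambda>n. a * c ^ n) * (1 - fps_const c * fps_X) =
        Abs_fps (\<lambda>n. a * c ^ n) - fps_const c * (fps_X * Abs_fps (\<lambda>n. a * c ^ n))"
      by (simp add: algebra_simps)
    then show "fps_nth (Abs_fps (\<lambda>n. a * c ^ n) * (1 - fps_const c * fps_X)) n = fps_nth (fps_const a) n"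
      by (cases n) simp_all
  qed
  moreover have "1 - fps_const c * fps_X \<noteq> 0"
  proof
    assume "1 - fps_const c * fps_X = 0"
    then have "fps_nth (1 - fps_const c * fps_X) 0 = 0" by simp
    then show False by simp
  qed
  ultimately show ?thesis
    by (metis nonzero_mult_div_cancel_right)
qed

theorem lemma5p4:
  fixes G :: "('a, 'b) monoid_scheme" and p m :: nat
  assumes "prime p" and "odd p"
    and "group G" and "order G = p ^ m"
    and "isoclinism_rank p G = 5"
    and "in_Phi5 p G"
  shows "(fps_compose (A_series G) (fps_const (1 / real (order G)) * fps_X) =
           fps_const (1 - real p powi (-4)) / (1 - fps_const (real p powi (-1)) * fps_X)
         + fps_const (real p powi (-4)) / (1 - fps_X))
       \<and> (fps_compose (B_series G) (fps_const (1 / real (order G)) * fps_X) =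
           1 / (1 - fps_const (real p powi (-4)) * fps_X)
         + fps_const (- real p - 1 - real p powi (-1) - real p powi (-2))
             / (1 - fps_const (real p powi (-3)) * fps_X)
         + fps_const (real p + 1 + real p powi (-1) + real p powi (-2))
             / (1 - fps_const (real p powi (-2)) * fps_X))"
proof -
  have p: "real p > 0" using prime_gt_0_nat[OF assms(1)] by simp
  have "order G > 0" using assms(4) prime_gt_0_nat[OF assms(1)] by simp
  then have fin: "finite (carrier G)"
    using card_gt_0_iff by (auto simp: order_def)
  have iso: "isoclinic G (Phi5_1_5 p)" using assms(6) by (simp add: in_Phi5_def)
  interpret small_derived_group G p
    by (rule group.isoclinic_Phi5(1)[OF assms(3) fin assms(1) iso])
  have r: "order G = p ^ 4 * card (center G)"
    by (rule group.isoclinic_Phi5(2)[OF assms(3) fin assms(1) iso])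
  have powi: "real p powi (-1) = 1 / real p" "real p powi (-2) = 1 / real p ^ 2"
    "real p powi (-3) = 1 / real p ^ 3" "real p powi (-4) = 1 / real p ^ 4"
    by (simp_all add: power_int_def divide_inverse power_inverse)
  \<comment> \<open>Two of the fractions lack the general shape: numerator 1 and denominator
    \<open>1 - fps_X\<close> are the cases \<open>a = 1\<close> and \<open>c = 1\<close>.\<close>
  have one: "1 / (1 - fps_const c * fps_X) = Abs_fps (\<lambda>n. c ^ n)"
    "fps_const c / (1 - fps_X) = Abs_fps (\<lambda>n. c)" for c :: real
    using fps_const_div_one_minus_const_X[of 1 c] fps_const_div_one_minus_const_X[of c 1] by simp_all
  \<comment> \<open>Substituting a multiple of \<open>fps_X\<close> scales the coefficient of index
    \<open>n\<close> by the \<open>n\<close>-th power of the factor, so the claims reduce to these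
    coefficient identities.\<close>
  have "(1 / real (order G)) ^ n * real (alpha G n) =
      (1 - 1 / real p ^ 4) * (1 / real p) ^ n + 1 / real p ^ 4" for n
    using alpha_div_order_power[OF r, of n] by (simp add: power_one_over)
  moreover have "(1 / real (order G)) ^ n * real (beta G n) =
      (1 / real p ^ 4) ^ n + (- real p - 1 - 1 / real p - 1 / real p ^ 2) * (1 / real p ^ 3) ^ n
      + (real p + 1 + 1 / real p + 1 / real p ^ 2) * (1 / real p ^ 2) ^ n" for n
    using beta_div_order_power[OF r, of n]
    by (simp add: power_one_over power_mult diff_divide_distrib add_divide_distrib)
  ultimately show ?thesis
    unfolding powi one fps_const_div_one_minus_const_X fps_compose_linear A_series_def B_series_def
    by (simp add: fps_eq_iff)
qed

end
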